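(* One has $c(k) = \Omega(1/k)$ for $k \ge 2$; that is, there exists an absolute constant $C > 0$ such that for every integer $k \ge 2$, $$c(k) \ge \frac{C}{k},$$ where $c(k) = \inf_G \{ f(G,1,k)/|G| \}$, the infimum being over all bipartite graphs $G$ with minimum degree $\delta(G) \ge 1$.
   Context: Graphs are finite, simple and have at least one vertex; $|G|$ denotes the number of vertices (the order) of $G$, and $\delta(G)$ its minimum degree. Given a graph $G$ and integers $q > r \ge 0$, $f(G,r,q)$ denotes the maximum order of an induced subgraph $H$ of $G$ such that $\deg_H(v) \equiv r \pmod{q}$ for all vertices $v$ of $H$, where $\deg_H(v)$ is the degree of $v$ within $H$; if no such $H$ exists, $f(G,r,q) = 0$. For an integer $k \ge 2$, $c(k)$ is defined as $\inf_G \{ f(G,1,k)/|G| \}$, where $G$ ranges over all bipartite graphs with $\delta(G) \ge 1$ (i.e. bipartite graphs without isolated vertices). *)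

theory Defs
  imports Complex_Main "HOL-Number_Theory.Cong" "Graph_Theory.Digraph_Component"
begin

text \<open>
  A finite simple graph is a \<^locale>\<open>pair_graph\<close>: a finite, loop-free, symmetric set of arcs
  without parallel arcs. Each edge is represented by its two opposite arcs, so the degree of
  a vertex is its out-degree.
\<close>

definition finite_simple_graph :: "'a pair_pre_digraph \<Rightarrow> bool" where
  "finite_simple_graph G \<longleftrightarrow> pair_graph G \<and> pverts G \<noteq> {}"

abbreviation graph_order :: "'a pair_pre_digraph \<Rightarrow> nat" where
  "graph_order G \<equiv> card (pverts G)"

abbreviation degree :: "'a pair_pre_digraph \<Rightarrow> 'a \<Rightarrow> nat" where
  "degree G v \<equiv> out_degree (with_proj G) v"

definition min_degree :: "'a pair_pre_digraph \<Rightarrow> nat" where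
  "min_degree G = Min (degree G ` pverts G)"

definition bipartite :: "'a pair_pre_digraph \<Rightarrow> bool" where
  "bipartite G \<longleftrightarrow> (\<exists>A B. A \<union> B = pverts G \<and> A \<inter> B = {} \<and> parcs G \<subseteq> A \<times> B \<union> B \<times> A)"

definition induced_mod_subgraph ::
    "'a pair_pre_digraph \<Rightarrow> 'a pair_pre_digraph \<Rightarrow> nat \<Rightarrow> nat \<Rightarrow> bool" where
  "induced_mod_subgraph H G r q \<longleftrightarrow>
     induced_subgraph (with_proj H) (with_proj G) \<and> pverts H \<noteq> {} \<and>
     (\<forall>v \<in> pverts H. [degree H v = r] (mod q))"

text \<open>The quantity \<open>f(G, r, q)\<close>.\<close>

definition max_mod_order :: "'a pair_pre_digraph \<Rightarrow> nat \<Rightarrow> nat \<Rightarrow> nat" where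
  "max_mod_order G r q =
     (if \<exists>H. induced_mod_subgraph H G r q
      then Max {graph_order H | H. induced_mod_subgraph H G r q}
      else 0)"

text \<open>
  The infimum \<open>c(k)\<close>. Vertices are taken to be natural numbers, which covers every finite graph
  up to isomorphism; see \<open>bipartite_mod_ratio_le\<close> below. The set of ratios is nonempty and
  bounded below by 0 (\<open>bipartite_mod_ratio_nonempty\<close>, \<open>bipartite_mod_ratio_bdd_below\<close>), so the
  real-valued infimum is the intended one.
\<close>

definition bipartite_mod_ratio :: "nat \<Rightarrow> real" where
  "bipartite_mod_ratio k =
     (INF G \<in> {G :: nat pair_pre_digraph.
                finite_simple_graph G \<and> bipartite G \<and> min_degree G \<ge> 1}.
        real (max_mod_order G 1 k) / real (graph_order G))"

lemma bipartite_mod_ratio_bdd_below: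
  "bdd_below ((\<lambda>G. real (max_mod_order G 1 k) / real (graph_order G)) ` X)"
  by (rule bdd_belowI[of _ 0]) auto

lemma bipartite_mod_ratio_nonempty:
  "{G :: nat pair_pre_digraph. finite_simple_graph G \<and> bipartite G \<and> min_degree G \<ge> 1} \<noteq> {}"
proof -
  define G :: "nat pair_pre_digraph" where "G = \<lparr>pverts = {0, 1}, parcs = {(0, 1), (1, 0)}\<rparr>"
  have "finite_simple_graph G"
    unfolding finite_simple_graph_def G_def
    by (auto intro!: pair_graph.intro pair_digraph.intro pair_pseudo_graph.intro
        simp: pair_fin_digraph_def pair_fin_digraph_axioms_def pair_wf_digraph_def
          pair_loopfree_digraph_def pair_loopfree_digraph_axioms_def
          pair_sym_digraph_def pair_sym_digraph_axioms_def symmetric_def sym_def)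
  moreover have "bipartite G"
    unfolding bipartite_def G_def by (intro exI[of _ "{0}"] exI[of _ "{1}"]) auto
  moreover have "out_arcs (with_proj G) 0 = {(0, 1)}" "out_arcs (with_proj G) 1 = {(1, 0)}"
    unfolding G_def out_arcs_def by auto
  then have "min_degree G \<ge> 1"
    by (simp add: min_degree_def out_degree_def) (simp add: G_def)
  ultimately show ?thesis by blast
qed

definition map_graph :: "('a \<Rightarrow> 'b) \<Rightarrow> 'a pair_pre_digraph \<Rightarrow> 'b pair_pre_digraph" where
  "map_graph h G = \<lparr>pverts = h ` pverts G, parcs = map_prod h h ` parcs G\<rparr>"

lemma map_graph_simps [simp]:
  "pverts (map_graph h G) = h ` pverts G" "parcs (map_graph h G) = map_prod h h ` parcs G"
  by (simp_all add: map_graph_def)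

lemma degree_map_graph:
  assumes "pair_wf_digraph G" "inj_on h (pverts G)" "v \<in> pverts G"
  shows "degree (map_graph h G) (h v) = degree G v"
proof -
  interpret pair_wf_digraph G by fact
  have "out_arcs (with_proj (map_graph h G)) (h v) = map_prod h h ` out_arcs (with_proj G) v"
  proof -
    have "x = v" if "h x = h v" "(x, y) \<in> parcs G" for x y
      using assms(2,3) that by (auto dest: in_arcsD1 inj_onD)
    then show ?thesis by (force simp: out_arcs_def)
  qed
  moreover have "inj_on (map_prod h h) (out_arcs (with_proj G) v)"
    using assms(2) by (auto simp: inj_on_def out_arcs_def dest: in_arcsD1 in_arcsD2)
  ultimately show ?thesis by (simp add: out_degree_def card_image)
qed

lemma pair_graph_map_graph:
  assumes "pair_graph G" "inj_on h (pverts G)"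
  shows "pair_graph (map_graph h G)"
proof -
  interpret pair_graph G by fact
  have "sym (map_prod h h ` parcs G)"
    by (rule symI) (force dest: arcs_symmetric)
  moreover have "h u \<noteq> h v" if "(u, v) \<in> parcs G" for u v
    using that assms(2) by (auto dest: in_arcsD1 in_arcsD2 no_loops' inj_onD)
  ultimately show ?thesis
    by (auto intro!: pair_graph.intro pair_digraph.intro pair_pseudo_graph.intro
        simp: pair_fin_digraph_def pair_fin_digraph_axioms_def pair_wf_digraph_def
          pair_loopfree_digraph_def pair_loopfree_digraph_axioms_def
          pair_sym_digraph_def pair_sym_digraph_axioms_def symmetric_def
          intro!: imageI intro: in_arcsD1 in_arcsD2)
qed

lemma induced_subgraph_pair_iff:
  assumes "pair_wf_digraph G"
  shows "induced_subgraph (with_proj H) (with_proj G) \<longleftrightarrow>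
    pverts H \<subseteq> pverts G \<and> parcs H = {e \<in> parcs G. fst e \<in> pverts H \<and> snd e \<in> pverts H}"
  using assms
  by (auto simp: induced_subgraph_def subgraph_def compatible_def wf_digraph_wp_iff
      pair_wf_digraph_def)

lemma induced_mod_subgraph_map_graph:
  assumes G: "pair_graph G" and h: "inj_on h (pverts G)" and H: "induced_mod_subgraph H G r q"
  shows "induced_mod_subgraph (map_graph h H) (map_graph h G) r q"
    and "graph_order (map_graph h H) = graph_order H"
proof -
  interpret pair_graph G by fact
  have M: "pair_wf_digraph (map_graph h G)"
    using pair_graph_map_graph[OF G h] by (auto simp: pair_graph_def pair_digraph_def
        pair_fin_digraph_def)
  have GH: "pverts H \<subseteq> pverts G" "parcs H = {e \<in> parcs G. fst e \<in> pverts H \<and> snd e \<in> pverts H}"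
    using H unfolding induced_mod_subgraph_def
    by (simp_all add: induced_subgraph_pair_iff pair_wf_digraph_axioms)
  have wfH: "pair_wf_digraph H" unfolding pair_wf_digraph_def GH(2) by simp
  have injH: "inj_on h (pverts H)" using h GH(1) by (rule inj_on_subset)
  show "graph_order (map_graph h H) = graph_order H" using injH by (simp add: card_image)
  have reflect: "h u \<in> h ` pverts H \<longleftrightarrow> u \<in> pverts H" if "u \<in> pverts G" for u
    using that h GH(1) by (auto dest: inj_onD)
  have "parcs (map_graph h H) = {e \<in> parcs (map_graph h G).
      fst e \<in> pverts (map_graph h H) \<and> snd e \<in> pverts (map_graph h H)}" (is "?L = ?R")
  proof (rule set_eqI, rule iffI)
    fix e assume "e \<in> ?L"
    then obtain d where d: "e = map_prod h h d" "d \<in> parcs H" unfolding map_graph_simps by (rule imageE)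
    from d(2) have "d \<in> parcs G" "fst d \<in> pverts H" "snd d \<in> pverts H"
      unfolding GH(2) by simp_all
    then show "e \<in> ?R" unfolding d(1) by simp
  next
    fix e assume "e \<in> ?R"
    then have e: "e \<in> map_prod h h ` parcs G" "fst e \<in> h ` pverts H" "snd e \<in> h ` pverts H"
      by simp_all
    from e(1) obtain d where d: "e = map_prod h h d" "d \<in> parcs G" by (rule imageE)
    with e(2,3) have "h (fst d) \<in> h ` pverts H" "h (snd d) \<in> h ` pverts H"
      by (simp_all only: fst_map_prod snd_map_prod)
    then have "fst d \<in> pverts H" "snd d \<in> pverts H"
      by (simp_all only: reflect[OF arc_fst_in_verts[OF d(2)]] reflect[OF arc_snd_in_verts[OF d(2)]])
    with d(2) have "d \<in> parcs H" unfolding GH(2) by (intro CollectI conjI)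
    then show "e \<in> ?L" using d(1) by simp
  qed
  then have "induced_subgraph (with_proj (map_graph h H)) (with_proj (map_graph h G))"
    unfolding induced_subgraph_pair_iff[OF M]
    using image_mono[OF GH(1), of h] by (simp only: map_graph_simps)
  moreover have "[degree (map_graph h H) w = r] (mod q)" if "w \<in> h ` pverts H" for w
  proof -
    from that obtain v where v: "w = h v" "v \<in> pverts H" by (rule imageE)
    then show ?thesis
      using H degree_map_graph[OF wfH injH v(2)] by (simp add: induced_mod_subgraph_def)
  qed
  moreover have "pverts H \<noteq> {}" using H by (simp add: induced_mod_subgraph_def)
  ultimately show "induced_mod_subgraph (map_graph h H) (map_graph h G) r q"
    by (simp only: induced_mod_subgraph_def map_graph_simps image_is_empty) blast
qed

lemma map_graph_inverse:
  assumes "pair_wf_digraph G" "inj_on h (pverts G)"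
  shows "map_graph (the_inv_into (pverts G) h) (map_graph h G) = G"
proof -
  interpret pair_wf_digraph G by fact
  let ?g = "the_inv_into (pverts G) h"
  have g: "?g (h v) = v" if "v \<in> pverts G" for v
    using assms(2) that by (rule the_inv_into_f_f)
  have "map_prod ?g ?g (map_prod h h e) = e" if "e \<in> parcs G" for e
    using that by (cases e) (auto simp: g dest: in_arcsD1 in_arcsD2)
  then have "map_prod ?g ?g ` map_prod h h ` parcs G = parcs G" by force
  moreover have "?g ` h ` pverts G = pverts G" using g by force
  ultimately show ?thesis by (simp add: map_graph_def)
qed

lemma max_mod_order_map_graph:
  assumes G: "pair_graph G" and h: "inj_on h (pverts G)"
  shows "max_mod_order (map_graph h G) r q = max_mod_order G r q"
proof -
  interpret pair_graph G by fact
  let ?g = "the_inv_into (pverts G) h"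
  have M: "pair_graph (map_graph h G)" using G h by (rule pair_graph_map_graph)
  have g: "inj_on ?g (pverts (map_graph h G))" using h by (simp add: inj_on_the_inv_into)
  have inverse: "map_graph ?g (map_graph h G) = G"
    using pair_wf_digraph_axioms h by (rule map_graph_inverse)
  have 1: "\<exists>H'. induced_mod_subgraph H' G r q \<and> graph_order H' = graph_order H"
    if "induced_mod_subgraph H (map_graph h G) r q" for H
    using induced_mod_subgraph_map_graph[OF M g that] unfolding inverse by blast
  have 2: "\<exists>H'. induced_mod_subgraph H' (map_graph h G) r q \<and> graph_order H' = graph_order H"
    if "induced_mod_subgraph H G r q" for H
    using induced_mod_subgraph_map_graph[OF G h that] by blast
  let ?P = "\<lambda>n. \<exists>H. n = graph_order H \<and> induced_mod_subgraph H (map_graph h G) r q"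
  let ?Q = "\<lambda>n. \<exists>H. n = graph_order H \<and> induced_mod_subgraph H G r q"
  have "?P n = ?Q n" for n
  proof
    assume "?P n" then show "?Q n" by (elim exE conjE) (drule 1, elim exE conjE, rule exI, rule conjI[rotated], assumption, simp)
  next
    assume "?Q n" then show "?P n" by (elim exE conjE) (drule 2, elim exE conjE, rule exI, rule conjI[rotated], assumption, simp)
  qed
  then have "?P = ?Q" by (rule ext)
  moreover have "(\<exists>H. induced_mod_subgraph H (map_graph h G) r q) \<longleftrightarrow>
      (\<exists>H. induced_mod_subgraph H G r q)"
    by (rule iffI; elim exE; (drule 1 | drule 2); elim exE conjE; rule exI; assumption)
  ultimately show ?thesis by (simp only: max_mod_order_def)
qed

lemma bipartite_mod_ratio_le:
  fixes G :: "'a pair_pre_digraph"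
  assumes G: "finite_simple_graph G" "bipartite G" "min_degree G \<ge> 1"
  shows "bipartite_mod_ratio k \<le> real (max_mod_order G 1 k) / real (graph_order G)"
proof -
  have pg: "pair_graph G" and ne: "pverts G \<noteq> {}"
    using G(1) by (auto simp: finite_simple_graph_def)
  interpret pair_graph G by (rule pg)
  obtain h :: "'a \<Rightarrow> nat" where h: "inj_on h (pverts G)"
    using finite_imp_inj_to_nat_seg[OF pair_finite_verts] by blast
  let ?M = "map_graph h G"
  have "finite_simple_graph ?M"
    using pair_graph_map_graph[OF pg h] ne by (simp add: finite_simple_graph_def)
  moreover have "bipartite ?M"
  proof -
    obtain A B where AB: "A \<union> B = pverts G" "A \<inter> B = {}" "parcs G \<subseteq> A \<times> B \<union> B \<times> A"
      using G(2) unfolding bipartite_def by blast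
    have "h ` A \<inter> h ` B = {}"
      using inj_on_image_Int[OF h, of A B] AB(1,2) by (metis image_empty sup_ge1 sup_ge2)
    then show ?thesis
      unfolding bipartite_def using AB
      by (intro exI[of _ "h ` A"] exI[of _ "h ` B"]) (auto simp flip: image_Un AB(1))
  qed
  moreover have "degree ?M ` pverts ?M = degree G ` pverts G"
    using degree_map_graph[OF pair_wf_digraph_axioms h] by (simp add: image_image)
  then have "min_degree ?M \<ge> 1" using G(3) by (simp add: min_degree_def)
  ultimately have "bipartite_mod_ratio k \<le> real (max_mod_order ?M 1 k) / real (graph_order ?M)"
    unfolding bipartite_mod_ratio_def
    by (intro cINF_lower bipartite_mod_ratio_bdd_below) simp
  then show ?thesis
    using max_mod_order_map_graph[OF pg h] h by (simp add: card_image)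
qed

end

theory Submission
  imports Defs
begin

text \<open>
  The constant is \<open>C = 1/5\<close>. Let \<open>A\<close> be the larger of the two sides of a bipartite graph without
  isolated vertices, \<open>B\<close> the other side, and \<open>N x \<subseteq> B\<close> the neighbourhood of \<open>x \<in> A\<close>.

  Let \<open>S\<^sub>0 \<subseteq> B\<close> be a smallest set dominating \<open>A\<close>. Every \<open>y \<in> S\<^sub>0\<close> has a private neighbour, a vertex of
  \<open>A\<close> whose only neighbour in \<open>S\<^sub>0\<close> is \<open>y\<close>, so there is an induced matching with \<open>2 |S\<^sub>0|\<close> vertices
  (\<open>exists_induced_matching\<close>). This is enough unless \<open>|S\<^sub>0| < |A|/(5k)\<close>.

  If \<open>S\<^sub>0\<close> is that small, \<open>k\<close> vertices of \<open>A\<close> can be spent on each of its elements. Choosing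
  \<open>S \<subseteq> B\<close> to minimise the number of undominated vertices plus \<open>k |S|\<close> gives every \<open>y \<in> S\<close> at
  least \<open>k\<close> private neighbours (\<open>exists_set_with_private_neighbours\<close>). Reserve \<open>k\<close> of them for
  each \<open>y\<close>. Reserved and undominated vertices together number at most \<open>k |S\<^sub>0|\<close>. For any
  \<open>T \<subseteq> S\<close>, the vertices of \<open>A\<close> that are not reserved and have degree 1 modulo \<open>k\<close> into \<open>T\<close> can be
  extended by reserved vertices, which have degree exactly 1 into \<open>T\<close> and repair the degrees in
  \<open>T\<close> independently of one another (\<open>exists_mod_selection\<close>).

  It remains to find a \<open>T\<close> for which a proportion \<open>1/(2k)\<close> of the dominated vertices qualify. A
  random subset of fixed density fails, because its intersection with a neighbourhood is
  concentrated and may hit the residue 1 with far too small a probability. Instead, let \<open>T\<close> be a prefix of uniformly random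
  length of a uniformly random ordering of \<open>S\<close>. For a vertex with \<open>d \<ge> 1\<close> neighbours in \<open>S\<close>, the
  size of \<open>N x \<inter> T\<close> is then uniform on \<open>{0..d}\<close>, and at least \<open>d/k\<close> of these \<open>d + 1\<close> values
  are 1 modulo \<open>k\<close>, a proportion of at least \<open>1/(2k)\<close>.
\<close>

section \<open>Random prefixes of random orderings\<close>

text \<open>
  The probability that a given \<open>t\<close>-subset of an \<open>m\<close>-set is the set of elements before a marker,
  when the marker and the \<open>m\<close> elements are put in a uniformly random order.
\<close>

definition prefix_weight :: "nat \<Rightarrow> nat \<Rightarrow> real" where
  "prefix_weight m t = fact t * fact (m - t) / fact (Suc m)"

text \<open>
  Removing one element from the random order turns the prefixes \<open>T\<close> and \<open>insert x T\<close> into \<open>T\<close>.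
\<close>

lemma prefix_weight_split:
  assumes "t \<le> m"
  shows "prefix_weight (Suc m) t + prefix_weight (Suc m) (Suc t) = prefix_weight m t"
proof -
  obtain r where m: "m = t + r" using assms le_Suc_ex by blast
  have "prefix_weight (Suc m) t + prefix_weight (Suc m) (Suc t)
      = fact t * fact r * (real (Suc r) + real (Suc t)) / (real (Suc (Suc m)) * fact (Suc m))"
    unfolding prefix_weight_def m by (simp add: Suc_diff_le add_divide_distrib algebra_simps)
  also have "real (Suc r) + real (Suc t) = real (Suc (Suc m))"
    unfolding m by simp
  finally show ?thesis
    unfolding prefix_weight_def m by (simp del: fact_Suc of_nat_Suc)
qed

lemma binomial_times_prefix_weight:
  assumes "t \<le> m"
  shows "real (m choose t) * prefix_weight m t = 1 / real (Suc m)"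
  using binomial_fact[OF assms, where 'a = real]
  by (simp add: prefix_weight_def del: of_nat_Suc)

text \<open>
  The trace of a random prefix on \<open>N\<close> is a random prefix of \<open>N\<close>: discard the elements outside \<open>N\<close>
  one at a time, using \<open>prefix_weight_split\<close>.
\<close>

lemma prefix_weight_marginal:
  fixes g :: "'b set \<Rightarrow> real"
  assumes "finite S" "N \<subseteq> S"
  shows "(\<Sum>T\<in>Pow S. prefix_weight (card S) (card T) * g (N \<inter> T))
    = (\<Sum>U\<in>Pow N. prefix_weight (card N) (card U) * g U)"
proof -
  have finN: "finite N" using assms by (rule finite_subset[rotated])
  have "(\<Sum>T\<in>Pow (N \<union> D). prefix_weight (card (N \<union> D)) (card T) * g (N \<inter> T))
      = (\<Sum>U\<in>Pow N. prefix_weight (card N) (card U) * g U)"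
    if "finite D" "D \<inter> N = {}" for D
    using that
  proof (induction D rule: finite_induct)
    case empty
    show ?case by (auto intro!: sum.cong simp: Int_absorb1)
  next
    case (insert x D)
    let ?M = "N \<union> D"
    let ?w = "\<lambda>T. prefix_weight (Suc (card ?M)) (card T) * g (N \<inter> T)"
    have x: "x \<notin> ?M" "finite ?M" "x \<notin> N" using insert finN by auto
    have "(\<Sum>T\<in>Pow (insert x ?M). ?w T) = (\<Sum>T\<in>Pow ?M. ?w T) + (\<Sum>T\<in>insert x ` Pow ?M. ?w T)"
      unfolding Pow_insert using x by (intro sum.union_disjoint) auto
    also have "(\<Sum>T\<in>insert x ` Pow ?M. ?w T) = (\<Sum>T\<in>Pow ?M. ?w (insert x T))"
      using x by (intro sum.reindex_cong[of "insert x"]) (auto simp: inj_on_def)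
    also have "(\<Sum>T\<in>Pow ?M. ?w T) + \<dots>
        = (\<Sum>T\<in>Pow ?M. prefix_weight (card ?M) (card T) * g (N \<inter> T))"
      unfolding sum.distrib[symmetric]
    proof (rule sum.cong[OF refl])
      fix T assume T: "T \<in> Pow ?M"
      then have "card T \<le> card ?M" "x \<notin> T" "finite T"
        using x by (auto intro: card_mono finite_subset)
      then show "?w T + ?w (insert x T) = prefix_weight (card ?M) (card T) * g (N \<inter> T)"
        using x by (simp add: distrib_right[symmetric] prefix_weight_split)
    qed
    finally show ?case using insert x by simp
  qed
  from this[of "S - N"] show ?thesis using assms by (simp add: Un_absorb1 Int_commute)
qed

text \<open>
  The size of a random prefix is uniform, since each size class has total weight
  \<open>1 / (card N + 1)\<close> by \<open>binomial_times_prefix_weight\<close>.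
\<close>

lemma prefix_weight_uniform:
  fixes h :: "nat \<Rightarrow> real"
  assumes "finite N"
  shows "(\<Sum>U\<in>Pow N. prefix_weight (card N) (card U) * h (card U))
    = (\<Sum>j\<le>card N. h j) / real (Suc (card N))"
proof -
  have "(\<Sum>U\<in>Pow N. prefix_weight (card N) (card U) * h (card U))
      = (\<Sum>j\<le>card N. \<Sum>U\<in>{U \<in> Pow N. card U = j}. prefix_weight (card N) (card U) * h (card U))"
    using assms by (intro sum.group[symmetric]) (auto intro: card_mono)
  also have "\<dots> = (\<Sum>j\<le>card N. h j / real (Suc (card N)))"
  proof (rule sum.cong[OF refl])
    fix j assume j: "j \<in> {..card N}"
    have "(\<Sum>U\<in>{U \<in> Pow N. card U = j}. prefix_weight (card N) (card U) * h (card U))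
        = real (card N choose j) * prefix_weight (card N) j * h j"
      using n_subsets[OF assms, of j] by simp
    also have "\<dots> = h j / real (Suc (card N))"
      using binomial_times_prefix_weight[of j "card N"] j by simp
    finally show "(\<Sum>U\<in>{U \<in> Pow N. card U = j}. prefix_weight (card N) (card U) * h (card U))
        = h j / real (Suc (card N))" .
  qed
  finally show ?thesis by (simp add: sum_divide_distrib)
qed

lemma card_cong_1_atMost_ge:
  assumes "k \<ge> 1" "d \<ge> 1"
  shows "d \<le> k * card {j. j \<le> d \<and> [j = 1] (mod k)}"
proof -
  let ?q = "(d - 1) div k"
  have "(\<lambda>i. 1 + i * k) ` {..?q} \<subseteq> {j. j \<le> d \<and> [j = 1] (mod k)}"
  proof clarify
    fix i assume "i \<le> ?q"
    then have "i * k \<le> ?q * k" by simp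
    also have "\<dots> \<le> d - 1" by simp
    finally have "1 + i * k \<le> d" using assms by linarith
    then show "1 + i * k \<le> d \<and> [1 + i * k = 1] (mod k)"
      by (simp only: cong_def mod_mult_self1)
  qed
  moreover have "inj_on (\<lambda>i. 1 + i * k) {..?q}" using assms by (auto simp: inj_on_def)
  ultimately have "Suc ?q \<le> card {j. j \<le> d \<and> [j = 1] (mod k)}"
    using card_inj_on_le[of "\<lambda>i. 1 + i * k" "{..?q}"] by simp
  then have "k * Suc ?q \<le> k * card {j. j \<le> d \<and> [j = 1] (mod k)}" by (rule mult_le_mono2)
  moreover have "d - 1 < k * Suc ?q"
    using dividend_less_times_div[of k "d - 1"] assms by simp
  ultimately show ?thesis by linarith
qed

lemma prefix_weight_cong_1_ge:
  assumes "finite S" "N \<subseteq> S" "N \<noteq> {}" "k \<ge> 1"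
  shows "1 / (2 * real k)
    \<le> (\<Sum>T\<in>Pow S. prefix_weight (card S) (card T) * of_bool [card (N \<inter> T) = 1] (mod k))"
proof -
  let ?d = "card N" and ?J = "{j. j \<le> card N \<and> [j = 1] (mod k)}"
  have finN: "finite N" using assms by (auto intro: finite_subset)
  have d: "?d \<ge> 1" using finN assms by (simp add: Suc_le_eq card_gt_0_iff)
  have J: "(\<Sum>j\<le>?d. of_bool [j = 1] (mod k)) = real (card ?J)"
    by (simp add: sum_of_bool_eq Collect_conj_eq atMost_def)
  have "real ?d \<le> real (k * card ?J)"
    using card_cong_1_atMost_ge[OF assms(4) d] by (simp only: of_nat_le_iff)
  moreover have "real (Suc ?d) \<le> 2 * real ?d" using d by simp
  ultimately have "real (Suc ?d) \<le> real (card ?J) * (2 * real k)" by (simp add: mult.commute)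
  then have "1 / (2 * real k) \<le> real (card ?J) / real (Suc ?d)"
    using assms(4) by (simp add: field_simps del: of_nat_Suc)
  also have "\<dots> = (\<Sum>U\<in>Pow N. prefix_weight ?d (card U) * of_bool [card U = 1] (mod k))"
    unfolding J[symmetric]
    by (rule prefix_weight_uniform[OF finN, of "\<lambda>j. of_bool [j = 1] (mod k)", symmetric])
  also have "\<dots> = (\<Sum>T\<in>Pow S. prefix_weight (card S) (card T) * of_bool [card (N \<inter> T) = 1] (mod k))"
    using prefix_weight_marginal[OF assms(1,2), of "\<lambda>U. of_bool [card U = 1] (mod k)"] by simp
  finally show ?thesis .
qed

text \<open>
  First-moment argument: by \<open>prefix_weight_cong_1_ge\<close> each single \<open>x\<close> is good with probability at
  least \<open>1/(2k)\<close>, so some prefix does at least as well as the expected number of good \<open>x\<close>.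
\<close>

lemma exists_subset_many_cong_1:
  assumes "finite S" "finite X" "\<And>x. x \<in> X \<Longrightarrow> N x \<inter> S \<noteq> {}" "k \<ge> 1"
  shows "\<exists>T\<subseteq>S. real (card X) \<le> 2 * real k * real (card {x \<in> X. [card (N x \<inter> T) = 1] (mod k)})"
proof (rule ccontr)
  let ?w = "\<lambda>T. prefix_weight (card S) (card T)"
  let ?c = "\<lambda>T. real (card {x \<in> X. [card (N x \<inter> T) = 1] (mod k)})"
  assume "\<not> ?thesis"
  then have less: "?c T < real (card X) / (2 * real k)" if "T \<subseteq> S" for T
    using that assms(4) by (force simp: field_simps not_le)
  have pos: "?w T > 0" for T by (simp add: prefix_weight_def del: fact_Suc)
  have total: "(\<Sum>T\<in>Pow S. ?w T) = 1"
    using prefix_weight_uniform[OF assms(1), of "\<lambda>_. 1"] by (simp add: field_simps)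
  have "real (card X) / (2 * real k) = (\<Sum>x\<in>X. 1 / (2 * real k))" by simp
  also have "\<dots> \<le> (\<Sum>x\<in>X. \<Sum>T\<in>Pow S. ?w T * of_bool [card (N x \<inter> T) = 1] (mod k))"
  proof (rule sum_mono)
    fix x assume "x \<in> X"
    have "N x \<inter> S \<inter> T = N x \<inter> T" if "T \<in> Pow S" for T using that by auto
    then show "1 / (2 * real k) \<le> (\<Sum>T\<in>Pow S. ?w T * of_bool [card (N x \<inter> T) = 1] (mod k))"
      using prefix_weight_cong_1_ge[OF assms(1) _ assms(3)[OF \<open>x \<in> X\<close>] assms(4)] by simp
  qed
  also have "\<dots> = (\<Sum>T\<in>Pow S. ?w T * (\<Sum>x\<in>X. of_bool [card (N x \<inter> T) = 1] (mod k)))"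
    by (subst sum.swap) (simp add: sum_distrib_left)
  also have "\<dots> = (\<Sum>T\<in>Pow S. ?w T * ?c T)"
    using assms(2) by (simp add: sum_of_bool_eq Int_def)
  also have "\<dots> < (\<Sum>T\<in>Pow S. ?w T * (real (card X) / (2 * real k)))"
    using assms(1) less pos by (intro sum_strict_mono mult_strict_left_mono) auto
  also have "\<dots> = real (card X) / (2 * real k)"
    unfolding sum_distrib_right[symmetric] total by simp
  finally show False by simp
qed

section \<open>Dominating sets and private neighbours\<close>

text \<open>
  In a smallest dominating set no vertex \<open>y\<close> can be dropped, so some \<open>x \<in> A\<close> is dominated by \<open>y\<close>
  alone. One such \<open>x\<close> for each \<open>y\<close> gives the matching.
\<close>

lemma exists_induced_matching:
  assumes "finite B" "\<forall>x\<in>A. N x \<inter> B \<noteq> {}"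
  shows "\<exists>S\<subseteq>B. (\<forall>x\<in>A. N x \<inter> S \<noteq> {}) \<and>
    (\<exists>X\<subseteq>A. card X = card S \<and> (\<forall>x\<in>X. card (N x \<inter> S) = 1) \<and>
      (\<forall>y\<in>S. card {x \<in> X. y \<in> N x} = 1))"
proof -
  let ?dom = "\<lambda>S. S \<subseteq> B \<and> (\<forall>x\<in>A. N x \<inter> S \<noteq> {})"
  obtain S where S: "?dom S" and min: "\<And>S'. ?dom S' \<Longrightarrow> card S \<le> card S'"
    using ex_has_least_nat[of ?dom B card] assms(2) by blast
  have finS: "finite S" using S assms(1) finite_subset by blast
  have "\<exists>x\<in>A. N x \<inter> S = {y}" if y: "y \<in> S" for y
  proof -
    have "card (S - {y}) < card S" using finS y by (rule card_Diff1_less)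
    then have "\<not> ?dom (S - {y})" using min not_le by blast
    then obtain x where "x \<in> A" "N x \<inter> (S - {y}) = {}" using S by blast
    then show ?thesis using S y by (intro bexI[of _ x]) auto
  qed
  then have "\<forall>y\<in>S. \<exists>x. x \<in> A \<and> N x \<inter> S = {y}" by blast
  then obtain p where p: "\<And>y. y \<in> S \<Longrightarrow> p y \<in> A \<and> N (p y) \<inter> S = {y}"
    using bchoice[of S "\<lambda>y x. x \<in> A \<and> N x \<inter> S = {y}"] by blast
  have inj: "inj_on p S" using p by (intro inj_onI) (metis singleton_inject)
  have "{x \<in> p ` S. y \<in> N x} = {p y}" if "y \<in> S" for y
  proof -
    have "z = y" if "z \<in> S" "y \<in> N (p z)" for z
    proof -
      have "y \<in> N (p z) \<inter> S" using that(2) \<open>y \<in> S\<close> by blast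
      then show ?thesis using p[OF that(1)] by simp
    qed
    moreover have "y \<in> N (p y) \<inter> S" using p[OF \<open>y \<in> S\<close>] by simp
    ultimately show ?thesis using \<open>y \<in> S\<close> by auto
  qed
  then have "\<forall>y\<in>S. card {x \<in> p ` S. y \<in> N x} = 1" by simp
  moreover have "p ` S \<subseteq> A" "\<forall>x\<in>p ` S. card (N x \<inter> S) = 1" using p by simp_all blast
  moreover have "card (p ` S) = card S" using inj by (rule card_image)
  ultimately show ?thesis using S by (intro exI[of _ S] conjI exI[of _ "p ` S"]) blast+
qed

text \<open>
  Dropping \<open>y\<close> from a set of least cost saves \<open>k\<close> and leaves exactly the private neighbours of \<open>y\<close>
  newly undominated, so there are at least \<open>k\<close> of these. The bound on the cost comes from
  comparison with \<open>S\<^sub>0\<close>, which leaves nothing undominated.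
\<close>

lemma exists_set_with_private_neighbours:
  assumes "S\<^sub>0 \<subseteq> B" "finite B" "\<forall>x\<in>A. N x \<inter> S\<^sub>0 \<noteq> {}"
  shows "\<exists>S\<subseteq>B. card {x \<in> A. N x \<inter> S = {}} + k * card S \<le> k * card S\<^sub>0 \<and>
    (\<forall>y\<in>S. k \<le> card {x \<in> A. N x \<inter> S = {y}})"
proof -
  let ?u = "\<lambda>S. {x \<in> A. N x \<inter> S = {}}"
  let ?cost = "\<lambda>S. card (?u S) + k * card S"
  obtain S where S: "S \<subseteq> B" and min: "\<And>S'. S' \<subseteq> B \<Longrightarrow> ?cost S \<le> ?cost S'"
    using ex_has_least_nat[of "\<lambda>S. S \<subseteq> B" B ?cost] by blast
  have finS: "finite S" using S assms(2) finite_subset by blast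
  have none: "?u S\<^sub>0 = {}" using assms(3) by blast
  have "?cost S \<le> k * card S\<^sub>0" using min[OF assms(1)] unfolding none by simp
  moreover have "k \<le> card {x \<in> A. N x \<inter> S = {y}}" if y: "y \<in> S" for y
  proof -
    have "?u (S - {y}) = ?u S \<union> {x \<in> A. N x \<inter> S = {y}}" using y by auto
    then have "card (?u (S - {y})) \<le> card (?u S) + card {x \<in> A. N x \<inter> S = {y}}"
      by (simp add: card_Un_le)
    moreover have "card S = Suc (card (S - {y}))" using card_Suc_Diff1[OF finS y] by simp
    moreover have "?cost S \<le> ?cost (S - {y})" using S by (intro min) auto
    ultimately show ?thesis by simp
  qed
  ultimately show ?thesis using S by blast
qed

text \<open>
  A private neighbour of \<open>y \<in> T \<subseteq> S\<close> has degree 1 into \<open>T\<close> and contributes to the degree of \<open>y\<close> only,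
  so adding reserved private neighbours corrects each degree in \<open>T\<close> without disturbing any other
  vertex. The vertices counted on the left of the bound are those that are neither undominated
  nor reserved.
\<close>

lemma exists_mod_selection:
  fixes N :: "'a \<Rightarrow> 'b set"
  assumes "finite A" "finite S" "k \<ge> 1"
    and priv: "\<forall>y\<in>S. k \<le> card {x \<in> A. N x \<inter> S = {y}}"
  shows "\<exists>X\<subseteq>A. \<exists>T\<subseteq>S. (\<forall>x\<in>X. [card (N x \<inter> T) = 1] (mod k)) \<and>
    (\<forall>y\<in>T. [card {x \<in> X. y \<in> N x} = 1] (mod k)) \<and>
    real (card A) - real (card {x \<in> A. N x \<inter> S = {}}) - real k * real (card S)
      \<le> 2 * real k * real (card X)"
proof -
  have "\<forall>y\<in>S. \<exists>R. R \<subseteq> {x \<in> A. N x \<inter> S = {y}} \<and> card R = k"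
  proof
    fix y assume "y \<in> S"
    with priv have "k \<le> card {x \<in> A. N x \<inter> S = {y}}" by blast
    then obtain R where "R \<subseteq> {x \<in> A. N x \<inter> S = {y}}" "card R = k"
      by (rule obtain_subset_with_card_n)
    then show "\<exists>R. R \<subseteq> {x \<in> A. N x \<inter> S = {y}} \<and> card R = k" by (intro exI conjI)
  qed
  from bchoice[OF this] obtain R
    where R_props: "\<forall>y\<in>S. R y \<subseteq> {x \<in> A. N x \<inter> S = {y}} \<and> card (R y) = k" by (elim exE)
  have R: "R y \<subseteq> {x \<in> A. N x \<inter> S = {y}}" and cardR: "card (R y) = k" if "y \<in> S" for y
    using R_props that by simp_all
  define F where "F = {x \<in> A. N x \<inter> S \<noteq> {}} - (\<Union>y\<in>S. R y)"
  have finF: "finite F" using assms(1) by (simp add: F_def)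
  have "card A \<le> card F + card {x \<in> A. N x \<inter> S = {}} + k * card S"
  proof -
    have "card (\<Union>y\<in>S. R y) \<le> k * card S"
      using card_UN_le[OF assms(2), of R] cardR by (simp add: mult.commute)
    moreover have "finite (\<Union>y\<in>S. R y)"
      using R assms(1) by (intro finite_subset[OF _ assms(1)]) blast
    then have "card A \<le> card (F \<union> {x \<in> A. N x \<inter> S = {}} \<union> (\<Union>y\<in>S. R y))"
      using assms(1) finF by (intro card_mono) (auto simp: F_def)
    moreover have "\<dots> \<le> card F + card {x \<in> A. N x \<inter> S = {}} + card (\<Union>y\<in>S. R y)"
      by (meson add_le_mono1 card_Un_le order_trans)
    ultimately show ?thesis by linarith
  qed
  then have bound: "real (card A) - real (card {x \<in> A. N x \<inter> S = {}}) - real k * real (card S)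
      \<le> real (card F)"
    by (simp flip: of_nat_mult of_nat_add)
  obtain T where T: "T \<subseteq> S"
    and many: "real (card F) \<le> 2 * real k * real (card {x \<in> F. [card (N x \<inter> T) = 1] (mod k)})"
    using exists_subset_many_cong_1[OF assms(2) finF _ assms(3), of N] by (auto simp: F_def)
  define F' where "F' = {x \<in> F. [card (N x \<inter> T) = 1] (mod k)}"
  have finF': "finite F'" using finF by (simp add: F'_def)
  have "\<exists>Q\<subseteq>R y. [card {x \<in> F'. y \<in> N x} + card Q = 1] (mod k)" if "y \<in> T" for y
  proof -
    define c where "c = card {x \<in> F'. y \<in> N x}"
    (* (k - 1) * c stands for - c, so that c + r is 1 modulo k *)
    define r where "r = (1 + (k - 1) * c) mod k"
    have "r \<le> card (R y)" using cardR that T assms(3) by (auto simp: r_def less_imp_le)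
    then obtain Q where Q: "Q \<subseteq> R y" "card Q = r" by (rule obtain_subset_with_card_n)
    have "(c + r) mod k = (c + (1 + (k - 1) * c)) mod k" by (simp add: r_def mod_add_right_eq)
    also have "c + (1 + (k - 1) * c) = 1 + c * k" using assms(3) by (cases k) auto
    also have "(1 + c * k) mod k = 1 mod k" by (rule mod_mult_self1)
    finally have "[c + card Q = 1] (mod k)" using Q(2) by (simp only: cong_def)
    then show ?thesis using Q(1) unfolding c_def by (intro exI conjI)
  qed
  then have "\<forall>y\<in>T. \<exists>Q. Q \<subseteq> R y \<and> [card {x \<in> F'. y \<in> N x} + card Q = 1] (mod k)" by blast
  from bchoice[OF this] obtain Q where Q_props:
    "\<forall>y\<in>T. Q y \<subseteq> R y \<and> [card {x \<in> F'. y \<in> N x} + card (Q y) = 1] (mod k)" by (elim exE)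
  have Q: "Q y \<subseteq> R y"
    and fix_deg: "[card {x \<in> F'. y \<in> N x} + card (Q y) = 1] (mod k)" if "y \<in> T" for y
    using Q_props that by simp_all
  define X where "X = F' \<union> (\<Union>y\<in>T. Q y)"
  have nbr: "N x \<inter> S = {y}" "x \<in> A" "x \<notin> F'" if "y \<in> T" "x \<in> Q y" for x y
  proof -
    have "y \<in> S" "x \<in> R y" using that Q T by blast+
    then show "N x \<inter> S = {y}" "x \<in> A" "x \<notin> F'" using R by (auto simp: F'_def F_def)
  qed
  have nbr_y: "y \<in> N x" if "y \<in> T" "x \<in> Q y" for x y using nbr(1)[OF that] by blast
  have XA: "X \<subseteq> A" using nbr by (auto simp: X_def F'_def F_def)
  have "[card (N x \<inter> T) = 1] (mod k)" if "x \<in> X" for x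
  proof (cases "x \<in> F'")
    case False
    then have "\<exists>y\<in>T. x \<in> Q y" using that by (simp add: X_def)
    then obtain y where y: "y \<in> T" "x \<in> Q y" by blast
    then have "N x \<inter> T = {y}" using nbr(1)[OF y] T by blast
    then show ?thesis by simp
  qed (simp add: F'_def)
  moreover have "[card {x \<in> X. y \<in> N x} = 1] (mod k)" if y: "y \<in> T" for y
  proof -
    have "z = y" if "z \<in> T" "x \<in> Q z" "y \<in> N x" for x z
    proof -
      have "y \<in> N x \<inter> S" using that(3) y T by blast
      then show ?thesis using nbr(1)[OF that(1,2)] by simp
    qed
    then have "{x \<in> X. y \<in> N x} = {x \<in> F'. y \<in> N x} \<union> Q y"
      using nbr_y y unfolding X_def by blast
    moreover have "finite (Q y)" using nbr(2)[OF y] by (intro finite_subset[OF _ assms(1)]) blast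
    moreover have "{x \<in> F'. y \<in> N x} \<inter> Q y = {}" using nbr(3)[OF y] by blast
    ultimately show ?thesis using fix_deg[OF y] finF' by (simp add: card_Un_disjoint)
  qed
  moreover have "card F' \<le> card X"
    using XA assms(1) by (intro card_mono) (auto simp: X_def intro: finite_subset)
  then have "2 * real k * real (card F') \<le> 2 * real k * real (card X)"
    by (intro mult_left_mono) auto
  then have "real (card A) - real (card {x \<in> A. N x \<inter> S = {}}) - real k * real (card S)
      \<le> 2 * real k * real (card X)"
    using bound many by (simp add: F'_def)
  ultimately show ?thesis using XA T by blast
qed

text \<open>
  Write \<open>a\<close> and \<open>m\<close> for the sizes of \<open>A\<close> and \<open>S\<^sub>0\<close>. The matching has \<open>2 m\<close> vertices, and
  \<open>exists_mod_selection\<close> yields at least \<open>(a - k m)/(2k)\<close>. The two bounds agree at \<open>m = a/(5k)\<close>, where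
  both equal \<open>2a/(5k)\<close>.
\<close>

lemma exists_large_mod_selection:
  fixes N :: "'a \<Rightarrow> 'b set"
  assumes "finite A" "finite B" "\<forall>x\<in>A. N x \<inter> B \<noteq> {}" "k \<ge> 1"
  shows "\<exists>X\<subseteq>A. \<exists>Y\<subseteq>B. (\<forall>x\<in>X. [card (N x \<inter> Y) = 1] (mod k)) \<and>
    (\<forall>y\<in>Y. [card {x \<in> X. y \<in> N x} = 1] (mod k)) \<and>
    2 * real (card A) \<le> 5 * real k * (real (card X) + real (card Y))"
proof -
  obtain S\<^sub>0 M where S0: "S\<^sub>0 \<subseteq> B" "\<forall>x\<in>A. N x \<inter> S\<^sub>0 \<noteq> {}"
    and M: "M \<subseteq> A" "card M = card S\<^sub>0" "\<forall>x\<in>M. card (N x \<inter> S\<^sub>0) = 1"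
      "\<forall>y\<in>S\<^sub>0. card {x \<in> M. y \<in> N x} = 1"
    using exists_induced_matching[OF assms(2,3)] by (elim exE conjE) (rule that)
  show ?thesis
  proof (cases "real (card A) \<le> 5 * real k * real (card S\<^sub>0)")
    case True
    then show ?thesis using S0 M by (intro exI[of _ M] exI[of _ S\<^sub>0] conjI) auto
  next
    case False
    obtain S where S: "S \<subseteq> B"
      and cost: "card {x \<in> A. N x \<inter> S = {}} + k * card S \<le> k * card S\<^sub>0"
      and priv: "\<forall>y\<in>S. k \<le> card {x \<in> A. N x \<inter> S = {y}}"
      using exists_set_with_private_neighbours[OF S0(1) assms(2) _, of A N k] S0(2) by blast
    have finS: "finite S" using S assms(2) finite_subset by blast
    obtain X Y where XY: "X \<subseteq> A" "Y \<subseteq> S" "\<forall>x\<in>X. [card (N x \<inter> Y) = 1] (mod k)"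
      "\<forall>y\<in>Y. [card {x \<in> X. y \<in> N x} = 1] (mod k)"
      and large: "real (card A) - real (card {x \<in> A. N x \<inter> S = {}}) - real k * real (card S)
        \<le> 2 * real k * real (card X)"
      using exists_mod_selection[OF assms(1) finS assms(4) priv]
      by (elim exE conjE)
    have "real (card {x \<in> A. N x \<inter> S = {}}) + real k * real (card S) \<le> real k * real (card S\<^sub>0)"
      using cost by (simp flip: of_nat_mult of_nat_add)
    then have "2 * real (card A) \<le> 5 * (real k * real (card X))"
      using large False by (simp add: mult.assoc)
    also have "\<dots> \<le> 5 * real k * (real (card X) + real (card Y))"
      by (simp add: distrib_left)
    finally have "2 * real (card A) \<le> 5 * real k * (real (card X) + real (card Y))" .
    moreover have "Y \<subseteq> B" using XY S by blast
    ultimately show ?thesis using XY by (intro exI[of _ X] exI[of _ Y] conjI)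
  qed
qed

section \<open>Induced subgraphs of bipartite graphs\<close>

lemma degree_eq_card: "degree G v = card {w. (v, w) \<in> parcs G}"
proof -
  have "out_arcs (with_proj G) v = Pair v ` {w. (v, w) \<in> parcs G}" by (auto simp: out_arcs_def)
  then show ?thesis by (simp add: out_degree_def card_image inj_on_def)
qed

lemma graph_order_le_max_mod_order:
  assumes "finite (pverts G)" "induced_mod_subgraph H G r q"
  shows "graph_order H \<le> max_mod_order G r q"
proof -
  let ?O = "{graph_order H | H. induced_mod_subgraph H G r q}"
  have "?O \<subseteq> {..graph_order G}"
    using assms(1) by (auto simp: induced_mod_subgraph_def induced_subgraph_def subgraph_def
        intro!: card_mono)
  then have "finite ?O" by (rule finite_subset) simp
  then show ?thesis using assms(2) by (auto simp: max_mod_order_def intro!: Max_ge)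
qed

lemma max_mod_order_ge_side:
  assumes G: "pair_graph G" "A \<union> B = pverts G" "A \<inter> B = {}" "parcs G \<subseteq> A \<times> B \<union> B \<times> A"
    and deg: "\<And>x. x \<in> A \<Longrightarrow> degree G x \<ge> 1" and "A \<noteq> {}" "k \<ge> 1"
  shows "2 * real (card A) \<le> 5 * real k * real (max_mod_order G 1 k)"
proof -
  interpret pair_graph G by fact
  define N where "N x = {y. (x, y) \<in> parcs G}" for x
  have fin: "finite A" "finite B" using G(2) pair_finite_verts by (metis finite_Un)+
  have "\<forall>x\<in>A. N x \<inter> B \<noteq> {}"
  proof
    fix x assume x: "x \<in> A"
    have "card (N x) \<noteq> 0" using deg[OF x] by (simp add: degree_eq_card N_def)
    then have "N x \<noteq> {}" by auto
    then show "N x \<inter> B \<noteq> {}" using G(3,4) x by (auto simp: N_def)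
  qed
  from exists_large_mod_selection[OF fin this assms(7)]
  obtain X Y where XY: "X \<subseteq> A" "Y \<subseteq> B"
    and degX: "\<forall>x\<in>X. [card (N x \<inter> Y) = 1] (mod k)"
    and degY: "\<forall>y\<in>Y. [card {x \<in> X. y \<in> N x} = 1] (mod k)"
    and large: "2 * real (card A) \<le> 5 * real k * (real (card X) + real (card Y))"
    by (elim exE conjE) (rule that)
  define H where "H = \<lparr>pverts = X \<union> Y,
    parcs = {e \<in> parcs G. fst e \<in> X \<union> Y \<and> snd e \<in> X \<union> Y}\<rparr>"
  have "finite X" "finite Y" "X \<inter> Y = {}" using XY fin G(3) by (auto intro: finite_subset)
  then have order: "graph_order H = card X + card Y" by (simp add: H_def card_Un_disjoint)
  have "card A > 0" using assms(6) fin by (simp add: card_gt_0_iff)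
  then have "X \<union> Y \<noteq> {}" using large by (intro notI) auto
  moreover have "induced_subgraph (with_proj H) (with_proj G)"
    using XY G(2) by (subst induced_subgraph_pair_iff[OF pair_wf_digraph_axioms])
      (auto simp: H_def)
  moreover have "[degree H v = 1] (mod k)" if "v \<in> X \<union> Y" for v
  proof (cases "v \<in> X")
    case True
    then have "N v \<subseteq> B" using XY(1) G(3,4) by (auto simp: N_def)
    moreover have "{w. (v, w) \<in> parcs H} = N v \<inter> (X \<union> Y)"
      using True by (auto simp: H_def N_def)
    moreover have "B \<inter> X = {}" using XY(1) G(3) by blast
    ultimately have "{w. (v, w) \<in> parcs H} = N v \<inter> Y" by blast
    then show ?thesis using degX True by (simp add: degree_eq_card)
  next
    case False
    then have v: "v \<in> Y" using that by simp
    then have "{w. (v, w) \<in> parcs G} \<subseteq> A" using XY(2) G(3,4) by auto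
    moreover have "{w. (v, w) \<in> parcs H} = {w \<in> X \<union> Y. (v, w) \<in> parcs G}"
      using v by (auto simp: H_def)
    moreover have "A \<inter> Y = {}" using XY(2) G(3) by blast
    moreover have "(v, w) \<in> parcs G \<longleftrightarrow> v \<in> N w" for w
      using arcs_symmetric by (auto simp: N_def)
    ultimately have "{w. (v, w) \<in> parcs H} = {x \<in> X. v \<in> N x}" by blast
    then show ?thesis using degY that False by (simp add: degree_eq_card)
  qed
  ultimately have "induced_mod_subgraph H G 1 k" by (simp add: induced_mod_subgraph_def H_def)
  then have "card X + card Y \<le> max_mod_order G 1 k"
    using graph_order_le_max_mod_order[OF pair_finite_verts] order by metis
  then have "real (card X) + real (card Y) \<le> real (max_mod_order G 1 k)"
    by (simp flip: of_nat_add)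
  then have "5 * real k * (real (card X) + real (card Y)) \<le> 5 * real k * real (max_mod_order G 1 k)"
    by (intro mult_left_mono) auto
  with large show ?thesis by linarith
qed

lemma bipartite_max_mod_order_ge:
  assumes G: "finite_simple_graph G" "bipartite G" "min_degree G \<ge> 1" and k: "k \<ge> 1"
  shows "real (graph_order G) \<le> 5 * real k * real (max_mod_order G 1 k)"
proof -
  have pg: "pair_graph G" and ne: "pverts G \<noteq> {}"
    using G(1) by (auto simp: finite_simple_graph_def)
  interpret pair_graph G by (rule pg)
  obtain A B where AB: "A \<union> B = pverts G" "A \<inter> B = {}" "parcs G \<subseteq> A \<times> B \<union> B \<times> A"
    using G(2) unfolding bipartite_def by blast
  have fin: "finite A" "finite B" using AB(1) pair_finite_verts by (metis finite_Un)+
  have deg: "degree G v \<ge> 1" if "v \<in> pverts G" for v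
  proof -
    have "min_degree G \<le> degree G v"
      unfolding min_degree_def using that by (intro Min_le) auto
    then show ?thesis using G(3) by linarith
  qed
  have order: "graph_order G = card A + card B"
    using AB(1,2) fin by (metis card_Un_disjoint)
  have pos: "graph_order G > 0" using ne by (simp add: card_gt_0_iff)
  show ?thesis
  proof (cases "card B \<le> card A")
    case True
    then have "A \<noteq> {}" using order pos by auto
    then have "2 * real (card A) \<le> 5 * real k * real (max_mod_order G 1 k)"
      using AB deg k by (intro max_mod_order_ge_side[OF pg, of A B]) auto
    then show ?thesis using True order by simp
  next
    case False
    then have "B \<noteq> {}" by auto
    then have "2 * real (card B) \<le> 5 * real k * real (max_mod_order G 1 k)"
      using AB deg k by (intro max_mod_order_ge_side[OF pg, of B A]) auto
    then show ?thesis using False order by simp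
  qed
qed

theorem theorem2:
  shows "\<exists>C :: real. C > 0 \<and> (\<forall>k :: nat. k \<ge> 2 \<longrightarrow> bipartite_mod_ratio k \<ge> C / real k)"
proof (intro exI conjI allI impI)
  show "(1 / 5 :: real) > 0" by simp
  fix k :: nat assume k: "k \<ge> 2"
  show "bipartite_mod_ratio k \<ge> 1 / 5 / real k"
    unfolding bipartite_mod_ratio_def
  proof (rule cINF_greatest[OF bipartite_mod_ratio_nonempty])
    fix G :: "nat pair_pre_digraph"
    assume "G \<in> {G. finite_simple_graph G \<and> bipartite G \<and> min_degree G \<ge> 1}"
    then have G: "finite_simple_graph G" "bipartite G" "min_degree G \<ge> 1" by auto
    interpret pair_graph G using G(1) by (simp add: finite_simple_graph_def)
    have "graph_order G > 0" using G(1) by (simp add: finite_simple_graph_def card_gt_0_iff)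
    then show "1 / 5 / real k \<le> real (max_mod_order G 1 k) / real (graph_order G)"
      using bipartite_max_mod_order_ge[OF G, of k] k by (simp add: field_simps)
  qed
qed

end
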